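(* For every real Banach space $X$ with $\dim X\ge 2$, $$\mathrm{DR}_B(X)=\sup\{\Phi_X(u,v): u,v\in S_X,\ u\perp_B v\}.$$
   Context: $S_X$ denotes the unit sphere of $X$. Birkhoff orthogonality: $x\perp_B y$ iff $\|x+\lambda y\|\ge\|x\|$ for all $\lambda\in\mathbb R$. For nonzero $x,y\in X$ put $\alpha[x,y]=\left\|\frac{x}{\|x\|}-\frac{y}{\|y\|}\right\|$ (angular distance) and $\beta[x,y]=\left\|\frac{x}{\|y\|}-\frac{y}{\|x\|}\right\|$ (skew angular distance). The Birkhoff-orthogonal Dehghan--Rooin constant is $$\mathrm{DR}_B(X)=\sup\left\{\frac{\alpha[x,y]}{\beta[x,y]}: x,y\in X\setminus\{0\},\ x\perp_B y,\ \beta[x,y]\ne 0\right\}.$$ For $u,v\in S_X$ with $u\perp_B v$, the Birkhoff skew profile is $\Phi_X(u,v)=\sup_{t>0}\frac{\|u-v\|}{\|tu-t^{-1}v\|}$ (the denominator is never zero). *)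

theory Defs
  imports "HOL-Analysis.Analysis"
begin

definition birkhoff_orthogonal :: "'a::real_normed_vector \<Rightarrow> 'a \<Rightarrow> bool"
    (infix "\<bottom>\<^sub>B" 50) where
  "x \<bottom>\<^sub>B y \<longleftrightarrow> (\<forall>c::real. norm x \<le> norm (x + c *\<^sub>R y))"

definition angular_distance :: "'a::real_normed_vector \<Rightarrow> 'a \<Rightarrow> real" where
  "angular_distance x y = norm (x /\<^sub>R norm x - y /\<^sub>R norm y)"

definition skew_angular_distance :: "'a::real_normed_vector \<Rightarrow> 'a \<Rightarrow> real" where
  "skew_angular_distance x y = norm (x /\<^sub>R norm y - y /\<^sub>R norm x)"

text \<open>Suprema are taken in the extended reals, where they always are genuine least upper
  bounds; on the reals, the supremum of an unbounded or empty set would be an arbitrary value.\<close>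

definition DR_B :: "'a::real_normed_vector itself \<Rightarrow> ereal" where
  "DR_B _ = Sup {ereal (angular_distance x y / skew_angular_distance x y) | x y :: 'a.
     x \<noteq> 0 \<and> y \<noteq> 0 \<and> x \<bottom>\<^sub>B y \<and> skew_angular_distance x y \<noteq> 0}"

text \<open>Only meant for unit vectors with \<open>u \<bottom>\<^sub>B v\<close>; there the denominator is at least \<open>t\<close>.\<close>

definition birkhoff_skew_profile :: "'a::real_normed_vector \<Rightarrow> 'a \<Rightarrow> ereal" where
  "birkhoff_skew_profile u v =
     (SUP t\<in>{0::real<..}. ereal (norm (u - v) / norm (t *\<^sub>R u - inverse t *\<^sub>R v)))"

text \<open>Some Hamel basis has at least two elements. The library's \<open>dim\<close> is natural-number valued
  and gives \<open>0\<close> on infinite-dimensional spaces, which must be included here.\<close>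

definition dim_at_least_two :: "'a::real_vector itself \<Rightarrow> bool" where
  "dim_at_least_two _ \<longleftrightarrow>
     (\<exists>B::'a set. independent B \<and> span B = UNIV \<and> (infinite B \<or> card B \<ge> 2))"

end

theory Submission
  imports Defs
begin

text \<open>Write \<open>x = a u\<close> and \<open>y = b v\<close> with unit vectors \<open>u\<close>, \<open>v\<close> and \<open>a, b > 0\<close>. Birkhoff
  orthogonality does not depend on \<open>a\<close> and \<open>b\<close>, the angular distance of \<open>x\<close> and \<open>y\<close> is
  \<open>\<parallel>u - v\<parallel>\<close>, and their skew angular distance is \<open>\<parallel>t u - t\<^sup>-\<^sup>1 v\<parallel>\<close> for \<open>t = a / b\<close>, which takes all
  positive values. Hence both sides are suprema of the same quotients.\<close>

text \<open>Pulling \<open>t\<close> out of the norm leaves \<open>x\<close> plus the multiple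
  \<open>c / t\<close> of \<open>y\<close>, where orthogonality applies; for \<open>t = 0\<close>
  the left side vanishes. Having both coefficients free gives the scaling invariance as well as the
  bound on the denominators.\<close>

lemma birkhoff_orthogonal_norm_le:
  fixes x y :: "'a::real_normed_vector"
  assumes "x \<bottom>\<^sub>B y"
  shows "\<bar>t\<bar> * norm x \<le> norm (t *\<^sub>R x + c *\<^sub>R y)"
proof (cases "t = 0")
  case False
  have "\<bar>t\<bar> * norm x \<le> \<bar>t\<bar> * norm (x + (c / t) *\<^sub>R y)"
    using assms by (simp add: birkhoff_orthogonal_def mult_left_mono)
  also have "\<dots> = norm (t *\<^sub>R (x + (c / t) *\<^sub>R y))"
    by simp
  also have "t *\<^sub>R (x + (c / t) *\<^sub>R y) = t *\<^sub>R x + c *\<^sub>R y"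
    using False by (simp add: scaleR_add_right)
  finally show ?thesis .
qed simp

lemma birkhoff_orthogonal_scaleR:
  fixes x y :: "'a::real_normed_vector"
  assumes "x \<bottom>\<^sub>B y"
  shows "(a *\<^sub>R x) \<bottom>\<^sub>B (b *\<^sub>R y)"
  using birkhoff_orthogonal_norm_le[OF assms, of a] by (simp add: birkhoff_orthogonal_def)

text \<open>Whatever multiple of \<open>v\<close> is subtracted, orthogonality keeps the norm at
  least \<open>t * norm u\<close>. So every parameter \<open>t > 0\<close> of the profile yields a
  pair admissible in \<open>DR_B\<close>.\<close>

lemma birkhoff_orthogonal_denominator_pos:
  fixes u v :: "'a::real_normed_vector"
  assumes "u \<bottom>\<^sub>B v" "u \<noteq> 0" "t > 0"
  shows "norm (t *\<^sub>R u - s *\<^sub>R v) > 0"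
proof -
  have "0 < \<bar>t\<bar> * norm u"
    using assms by simp
  also have "\<dots> \<le> norm (t *\<^sub>R u - s *\<^sub>R v)"
    using birkhoff_orthogonal_norm_le[OF assms(1), of t "- s"] by simp
  finally show ?thesis .
qed

lemma angular_distance_scaleR_unit:
  fixes u v :: "'a::real_normed_vector"
  assumes "norm u = 1" "norm v = 1" "a > 0" "b > 0"
  shows "angular_distance (a *\<^sub>R u) (b *\<^sub>R v) = norm (u - v)"
  using assms by (simp add: angular_distance_def)

lemma skew_angular_distance_scaleR_unit:
  fixes u v :: "'a::real_normed_vector"
  assumes "norm u = 1" "norm v = 1" "a > 0" "b > 0"
  shows "skew_angular_distance (a *\<^sub>R u) (b *\<^sub>R v) =
    norm ((a / b) *\<^sub>R u - inverse (a / b) *\<^sub>R v)"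
  using assms by (simp add: skew_angular_distance_def divide_inverse mult.commute)

theorem theorem2p2:
  assumes "dim_at_least_two TYPE('a::banach)"
  shows "DR_B TYPE('a) =
    Sup {birkhoff_skew_profile u v | u v :: 'a. u \<in> sphere 0 1 \<and> v \<in> sphere 0 1 \<and> u \<bottom>\<^sub>B v}"
    (is "_ = Sup ?P")
proof (rule antisym)
  show "DR_B TYPE('a) \<le> Sup ?P"
    unfolding DR_B_def
  proof (rule Sup_least, clarify)
    fix x y :: 'a
    assume xy: "x \<noteq> 0" "y \<noteq> 0" "x \<bottom>\<^sub>B y"
    define u v t where "u = x /\<^sub>R norm x" and "v = y /\<^sub>R norm y" and "t = norm x / norm y"
    have unit: "norm u = 1" "norm v = 1"
      using xy by (simp_all add: u_def v_def)
    have uv: "u \<bottom>\<^sub>B v"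
      unfolding u_def v_def using xy(3) by (rule birkhoff_orthogonal_scaleR)
    have t: "t \<in> {0<..}"
      using xy by (simp add: t_def)
    have "x = norm x *\<^sub>R u" "y = norm y *\<^sub>R v"
      using xy by (simp_all add: u_def v_def)
    then have eq: "angular_distance x y = norm (u - v)"
      "skew_angular_distance x y = norm (t *\<^sub>R u - inverse t *\<^sub>R v)"
      using angular_distance_scaleR_unit[OF unit, of "norm x" "norm y"]
        skew_angular_distance_scaleR_unit[OF unit, of "norm x" "norm y"] xy
      by (simp_all add: t_def)
    \<comment> \<open>The quotient of \<open>x\<close> and \<open>y\<close> is the term with
      parameter \<open>t\<close> in the supremum defining the profile of \<open>u\<close> and
      \<open>v\<close>.\<close>
    have "ereal (angular_distance x y / skew_angular_distance x y) \<le> birkhoff_skew_profile u v"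
      unfolding birkhoff_skew_profile_def eq using t by (rule SUP_upper)
    also have "\<dots> \<le> Sup ?P"
      using unit uv by (intro Sup_upper) auto
    finally show "ereal (angular_distance x y / skew_angular_distance x y) \<le> Sup ?P" .
  qed
next
  show "Sup ?P \<le> DR_B TYPE('a)"
  proof (rule Sup_least, clarify)
    fix u v :: 'a
    assume "u \<in> sphere 0 1" "v \<in> sphere 0 1" and uv: "u \<bottom>\<^sub>B v"
    then have unit: "norm u = 1" "norm v = 1"
      by simp_all
    then have nz: "u \<noteq> 0" "v \<noteq> 0"
      by auto
    show "birkhoff_skew_profile u v \<le> DR_B TYPE('a)"
      unfolding birkhoff_skew_profile_def
    proof (rule SUP_least)
      fix t :: real
      assume "t \<in> {0<..}"
      then have t: "t > 0"
        by simp
      \<comment> \<open>The pair \<open>t *\<^sub>R u\<close>, \<open>v\<close> realizes the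
        parameter \<open>t\<close>: its norms are \<open>t\<close> and 1, so their ratio is
        \<open>t\<close>.\<close>
      have eq: "angular_distance (t *\<^sub>R u) v = norm (u - v)"
        "skew_angular_distance (t *\<^sub>R u) v = norm (t *\<^sub>R u - inverse t *\<^sub>R v)"
        using angular_distance_scaleR_unit[OF unit t, of 1]
          skew_angular_distance_scaleR_unit[OF unit t, of 1] by simp_all
      have "t *\<^sub>R u \<noteq> 0"
        using t nz by simp
      moreover have "(t *\<^sub>R u) \<bottom>\<^sub>B v"
        using birkhoff_orthogonal_scaleR[OF uv, of t 1] by simp
      moreover have "skew_angular_distance (t *\<^sub>R u) v \<noteq> 0"
        using birkhoff_orthogonal_denominator_pos[OF uv nz(1) t, of "inverse t"] eq(2) by linarith
      ultimately show "ereal (norm (u - v) / norm (t *\<^sub>R u - inverse t *\<^sub>R v)) \<le> DR_B TYPE('a)"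
        unfolding DR_B_def eq[symmetric] using nz(2) by (intro Sup_upper) blast
    qed
  qed
qed

end
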